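(* Let $G$ be a group, let $R$ be a $G$-graded ring, and let $I$ be a graded ideal of $R$ (i.e. a proper two-sided ideal that is graded). Then $I$ is a graded almost prime right ideal of $R$ if and only if $I/I^{2}$ is a graded weakly prime right ideal of $R/I^{2}$.
   Context: Rings are associative, not assumed commutative, and not assumed to have a unity. A ring $R$ is $G$-graded if $R=\bigoplus_{g\in G}R_g$ with $R_g$ additive subgroups and $R_gR_h\subseteq R_{gh}$ for all $g,h\in G$; $x_g$ denotes the component of $x\in R$ in $R_g$. A (one- or two-sided) ideal $P$ is graded if $P=\bigoplus_{g\in G}(P\cap R_g)$, i.e. $x\in P$ implies $x_g\in P$ for all $g\in G$. By "ideal" is meant a proper two-sided ideal. The product $XY$ of right ideals is the set of finite sums of products $xy$ with $x\in X$, $y\in Y$, and $P^2=PP$. For a graded two-sided ideal $K$ of $R$, the quotient $R/K$ is $G$-graded by $(R/K)_g=(R_g+K)/K$. A proper graded right ideal $P$ of a graded ring $R$ is graded almost prime if, for all graded right ideals $X,Y$ of $R$, $XY\subseteq P$ and $XY\nsubseteq P^2$ imply $X\subseteq P$ or $Y\subseteq P$. It is graded weakly prime if, for all graded right ideals $X,Y$ of $R$, $0\neq XY\subseteq P$ implies $X\subseteq P$ or $Y\subseteq P$. *)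

theory Defs
  imports "HOL-Algebra.Ideal_Product" "HOL-Algebra.QuotRing"
begin

text \<open>
  The library's locale \<^locale>\<open>ring\<close> requires a unity, so associative rings without an assumed unity
  are introduced here over the same record type. The record field for the unity is left
  unconstrained and never used. The notions \<^const>\<open>ideal_prod\<close> (finite sums of products) and
  \<^const>\<open>FactRing\<close> are defined by the library on bare records, so they apply to such rings as well.
\<close>

locale rng = abelian_group R for R (structure) +
  assumes m_closed: "\<lbrakk> x \<in> carrier R; y \<in> carrier R \<rbrakk> \<Longrightarrow> x \<otimes> y \<in> carrier R"
    and m_assoc: "\<lbrakk> x \<in> carrier R; y \<in> carrier R; z \<in> carrier R \<rbrakk>
      \<Longrightarrow> (x \<otimes> y) \<otimes> z = x \<otimes> (y \<otimes> z)"
    and l_distr: "\<lbrakk> x \<in> carrier R; y \<in> carrier R; z \<in> carrier R \<rbrakk>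
      \<Longrightarrow> (x \<oplus> y) \<otimes> z = x \<otimes> z \<oplus> y \<otimes> z"
    and r_distr: "\<lbrakk> x \<in> carrier R; y \<in> carrier R; z \<in> carrier R \<rbrakk>
      \<Longrightarrow> z \<otimes> (x \<oplus> y) = z \<otimes> x \<oplus> z \<otimes> y"

definition homogeneous_decomposition ::
  "('g, 'm) monoid_scheme \<Rightarrow> ('a, 'n) ring_scheme \<Rightarrow> ('g \<Rightarrow> 'a set) \<Rightarrow> 'a \<Rightarrow> ('g \<Rightarrow> 'a) \<Rightarrow> bool" where
  "homogeneous_decomposition G R A x f \<longleftrightarrow>
     f \<in> (\<Pi>\<^sub>E g\<in>carrier G. A g) \<and>
     finite {g \<in> carrier G. f g \<noteq> \<zero>\<^bsub>R\<^esub>} \<and>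
     x = (\<Oplus>\<^bsub>R\<^esub>g\<in>{g \<in> carrier G. f g \<noteq> \<zero>\<^bsub>R\<^esub>}. f g)"

text \<open>The component \<open>x\<^sub>g\<close>; meaningful for \<open>g\<close> in \<^term>\<open>carrier G\<close> once decompositions are unique.\<close>

definition component ::
  "('g, 'm) monoid_scheme \<Rightarrow> ('a, 'n) ring_scheme \<Rightarrow> ('g \<Rightarrow> 'a set) \<Rightarrow> 'a \<Rightarrow> 'g \<Rightarrow> 'a" where
  "component G R A x g = (THE f. homogeneous_decomposition G R A x f) g"

text \<open>The family \<open>A\<close> is the grading; \<open>direct_sum\<close> says that \<open>R\<close> is the internal direct sum of the
  subgroups \<open>A g\<close>.\<close>

locale graded_rng = grp: group G + rng R
  for G :: "('g, 'm) monoid_scheme" and R :: "('a, 'n) ring_scheme" (structure) +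
  fixes A :: "'g \<Rightarrow> 'a set"
  assumes homogeneous_subgroup: "g \<in> carrier G \<Longrightarrow> additive_subgroup (A g) R"
    and homogeneous_mult: "\<lbrakk> g \<in> carrier G; h \<in> carrier G; x \<in> A g; y \<in> A h \<rbrakk>
      \<Longrightarrow> x \<otimes> y \<in> A (g \<otimes>\<^bsub>G\<^esub> h)"
    and direct_sum: "x \<in> carrier R \<Longrightarrow> \<exists>!f. homogeneous_decomposition G R A x f"

locale graded_right_ideal = graded_rng G R A + additive_subgroup P R
  for G :: "('g, 'm) monoid_scheme" and R :: "('a, 'n) ring_scheme" (structure)
    and A :: "'g \<Rightarrow> 'a set" and P :: "'a set" +
  assumes right_closed: "\<lbrakk> x \<in> P; r \<in> carrier R \<rbrakk> \<Longrightarrow> x \<otimes> r \<in> P"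
    and component_closed: "\<lbrakk> x \<in> P; g \<in> carrier G \<rbrakk> \<Longrightarrow> component G R A x g \<in> P"

text \<open>As usual for two-sided ideals in this setting, properness is part of the notion.\<close>

locale graded_ideal = graded_right_ideal +
  assumes left_closed: "\<lbrakk> x \<in> P; r \<in> carrier R \<rbrakk> \<Longrightarrow> r \<otimes> x \<in> P"
    and proper: "P \<noteq> carrier R"

text \<open>In both primeness notions \<open>P\<close> is proper, while the test ideals \<open>X\<close> and \<open>Y\<close> may be all of \<open>R\<close>.\<close>

locale graded_almost_prime = graded_right_ideal +
  assumes proper: "P \<noteq> carrier R"
    and almost_prime: "\<lbrakk> graded_right_ideal G R A X; graded_right_ideal G R A Y;
        X \<cdot> Y \<subseteq> P; \<not> X \<cdot> Y \<subseteq> P \<cdot> P \<rbrakk> \<Longrightarrow> X \<subseteq> P \<or> Y \<subseteq> P"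

locale graded_weakly_prime = graded_right_ideal +
  assumes proper: "P \<noteq> carrier R"
    and weakly_prime: "\<lbrakk> graded_right_ideal G R A X; graded_right_ideal G R A Y;
        X \<cdot> Y \<noteq> {\<zero>}; X \<cdot> Y \<subseteq> P \<rbrakk> \<Longrightarrow> X \<subseteq> P \<or> Y \<subseteq> P"

text \<open>The image \<open>S/K\<close> of a subset \<open>S\<close> of \<open>R\<close> under the projection to \<open>R/K\<close>.\<close>

definition quotient_image :: "('a, 'n) ring_scheme \<Rightarrow> 'a set \<Rightarrow> 'a set \<Rightarrow> 'a set set" where
  "quotient_image R K S = (\<lambda>x. K +>\<^bsub>R\<^esub> x) ` S"

definition quotient_grading ::
  "('a, 'n) ring_scheme \<Rightarrow> ('g \<Rightarrow> 'a set) \<Rightarrow> 'a set \<Rightarrow> 'g \<Rightarrow> 'a set set" where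
  "quotient_grading R A K g = quotient_image R K (A g <+>\<^bsub>R\<^esub> K)"

end

theory Submission
  imports Defs
begin

text \<open>
  Write \<open>K = I\<^sup>2\<close> and \<open>\<pi> : R \<rightarrow> R/K\<close>. Almost primeness exempts the products
  that lie in \<open>K\<close>, and weak primeness of \<open>I/K\<close> exempts the products that vanish in \<open>R/K\<close>; since
  \<open>\<pi>(XY) = \<pi>(X)\<pi>(Y)\<close> (\<open>quotient_image_product\<close>), these are the same exemption
  (\<open>quotient_product_zero_iff\<close>). Inclusions in \<open>I\<close> and in \<open>I/K\<close> also correspond, because
  \<open>K \<subseteq> I\<close> (\<open>mem_quotient_image_iff\<close>). It remains to move the test ideals across: a pair of
  graded right ideals of \<open>R\<close> is tested through its images, and a pair in \<open>R/K\<close> through its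
  preimages, whose images are the given ideals.

  What takes work is that \<open>R/K\<close> is a graded ring at all. First, \<open>K\<close> is again a graded ideal
  (\<open>square_graded_ideal\<close>): the factors of a product in \<open>K\<close> split into homogeneous parts that
  stay in \<open>I\<close>, so \<open>K\<close> is spanned by homogeneous elements. Secondly, for any graded ideal \<open>P\<close>,
  a coset \<open>P + x\<close> has exactly one decomposition, namely \<open>g \<mapsto> P + x\<^sub>g\<close>
  (\<open>quotient_decomposition_iff\<close>). This identifies the components in the quotient, and with
  them images and preimages of graded right ideals are graded.
\<close>

section \<open>Homogeneous components\<close>

context rng
begin

lemma zero_mult_left: "x \<in> carrier R \<Longrightarrow> \<zero> \<otimes> x = \<zero>"
  by (metis add.l_cancel_one add.one_closed l_distr l_zero m_closed)

lemma zero_mult_right: "x \<in> carrier R \<Longrightarrow> x \<otimes> \<zero> = \<zero>"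
  by (metis add.l_cancel_one add.one_closed r_distr l_zero m_closed)

lemma minus_mult_left:
  assumes "x \<in> carrier R" "y \<in> carrier R"
  shows "\<ominus> (x \<otimes> y) = (\<ominus> x) \<otimes> y"
proof (rule minus_equality)
  show "(\<ominus> x) \<otimes> y \<oplus> x \<otimes> y = \<zero>"
    using assms by (simp add: l_distr [symmetric] l_neg zero_mult_left)
qed (use assms in \<open>auto intro: m_closed\<close>)

end

context graded_rng
begin

lemma homogeneous_carrier: "g \<in> carrier G \<Longrightarrow> a \<in> A g \<Longrightarrow> a \<in> carrier R"
  using homogeneous_subgroup additive_subgroup.a_Hcarr by metis

lemma decomposition_component:
  assumes "x \<in> carrier R"
  shows "homogeneous_decomposition G R A x (component G R A x)"
proof -
  have "component G R A x = (THE f. homogeneous_decomposition G R A x f)"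
    by (rule ext) (simp add: component_def)
  then show ?thesis
    using theI' [OF direct_sum [OF assms]] by simp
qed

lemma component_unique:
  assumes "x \<in> carrier R" "homogeneous_decomposition G R A x f"
  shows "component G R A x = f"
  using direct_sum [OF assms(1)] decomposition_component [OF assms(1)] assms(2) by blast

lemma component_homogeneous:
  "x \<in> carrier R \<Longrightarrow> g \<in> carrier G \<Longrightarrow> component G R A x g \<in> A g"
  using decomposition_component unfolding homogeneous_decomposition_def by blast

lemma component_carrier:
  "x \<in> carrier R \<Longrightarrow> g \<in> carrier G \<Longrightarrow> component G R A x g \<in> carrier R"
  using component_homogeneous homogeneous_carrier by blast

lemma finite_support:
  "x \<in> carrier R \<Longrightarrow> finite {g \<in> carrier G. component G R A x g \<noteq> \<zero>}"
  using decomposition_component unfolding homogeneous_decomposition_def by blast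

lemma sum_of_components:
  assumes "x \<in> carrier R" "finite F" "F \<subseteq> carrier G"
    and "{g \<in> carrier G. component G R A x g \<noteq> \<zero>} \<subseteq> F"
  shows "(\<Oplus>g\<in>F. component G R A x g) = x"
proof -
  have "(\<Oplus>g\<in>F. component G R A x g) =
      (\<Oplus>g\<in>{g \<in> carrier G. component G R A x g \<noteq> \<zero>}. component G R A x g)"
    by (rule add.finprod_mono_neutral_cong_right) (use assms component_carrier in auto)
  then show ?thesis
    using decomposition_component [OF assms(1)] unfolding homogeneous_decomposition_def by simp
qed

text \<open>By uniqueness, any way of writing an element as a sum of homogeneous elements of distinct
  degrees already displays its components.\<close>

lemma component_sum:
  assumes "finite F" "F \<subseteq> carrier G" "\<And>g. g \<in> F \<Longrightarrow> a g \<in> A g" "h \<in> carrier G"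
  shows "component G R A (\<Oplus>g\<in>F. a g) h = (if h \<in> F then a h else \<zero>)"
proof -
  have aF: "a \<in> F \<rightarrow> carrier R"
    using assms homogeneous_carrier by blast
  define f where "f = (\<lambda>g\<in>carrier G. if g \<in> F then a g else \<zero>)"
  \<comment> \<open>Some \<open>a g\<close> with \<open>g \<in> F\<close> may be zero, so \<open>F\<close> can exceed the support.\<close>
  have "(\<Oplus>g\<in>F. a g) = (\<Oplus>g\<in>{g \<in> carrier G. f g \<noteq> \<zero>}. f g)"
    by (rule add.finprod_mono_neutral_cong_right) (use assms aF in \<open>auto simp: f_def\<close>)
  moreover have "f \<in> (\<Pi>\<^sub>E g\<in>carrier G. A g)"
    using assms homogeneous_subgroup additive_subgroup.zero_closed by (fastforce simp: f_def)
  moreover have "finite {g \<in> carrier G. f g \<noteq> \<zero>}"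
    by (rule finite_subset [OF _ assms(1)]) (auto simp: f_def)
  ultimately have "homogeneous_decomposition G R A (\<Oplus>g\<in>F. a g) f"
    unfolding homogeneous_decomposition_def by blast
  then have "component G R A (\<Oplus>g\<in>F. a g) = f"
    using aF by (intro component_unique) auto
  then show ?thesis
    using assms(4) by (simp add: f_def)
qed

lemma component_add:
  assumes x: "x \<in> carrier R" and y: "y \<in> carrier R" and h: "h \<in> carrier G"
  shows "component G R A (x \<oplus> y) h = component G R A x h \<oplus> component G R A y h"
proof -
  let ?S = "\<lambda>z. {g \<in> carrier G. component G R A z g \<noteq> \<zero>}"
  define F where "F = ?S x \<union> ?S y"
  have F: "finite F" "F \<subseteq> carrier G"
    using x y finite_support by (auto simp: F_def)
  have "x \<oplus> y = (\<Oplus>g\<in>F. component G R A x g) \<oplus> (\<Oplus>g\<in>F. component G R A y g)"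
    using sum_of_components [OF x F] sum_of_components [OF y F] by (simp add: F_def)
  also have "\<dots> = (\<Oplus>g\<in>F. component G R A x g \<oplus> component G R A y g)"
    using x y F component_carrier by (intro finsum_addf [symmetric]) auto
  finally have "component G R A (x \<oplus> y) h =
      component G R A (\<Oplus>g\<in>F. component G R A x g \<oplus> component G R A y g) h"
    by simp
  also have "\<dots> = (if h \<in> F then component G R A x h \<oplus> component G R A y h else \<zero>)"
  proof (rule component_sum [OF F _ h])
    fix g assume "g \<in> F"
    then have "g \<in> carrier G"
      using F by blast
    then show "component G R A x g \<oplus> component G R A y g \<in> A g"
      using x y component_homogeneous homogeneous_subgroup additive_subgroup.a_closed by metis
  qed
  also have "\<dots> = component G R A x h \<oplus> component G R A y h"
    using h by (auto simp: F_def)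
  finally show ?thesis .
qed

lemma component_homogeneous_element:
  assumes "g \<in> carrier G" "a \<in> A g" "h \<in> carrier G"
  shows "component G R A a h = (if h = g then a else \<zero>)"
  using component_sum [of "{g}" "\<lambda>_. a" h] assms homogeneous_carrier by simp

end

section \<open>Graded right ideals\<close>

context graded_right_ideal
begin

text \<open>An element of a graded right ideal is the sum of its components, which are homogeneous
  elements of the ideal; an additive property therefore needs to be checked on those only.\<close>

lemma homogeneous_induct [consumes 1, case_names zero add homogeneous]:
  assumes x: "x \<in> P" and zero: "Q \<zero>"
    and add: "\<And>a b. a \<in> P \<Longrightarrow> b \<in> P \<Longrightarrow> Q a \<Longrightarrow> Q b \<Longrightarrow> Q (a \<oplus> b)"
    and homogeneous: "\<And>g a. g \<in> carrier G \<Longrightarrow> a \<in> A g \<Longrightarrow> a \<in> P \<Longrightarrow> Q a"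
  shows "Q x"
proof -
  have xR: "x \<in> carrier R"
    using x by simp
  have *: "(\<Oplus>g\<in>F. component G R A x g) \<in> P \<and> Q (\<Oplus>g\<in>F. component G R A x g)"
    if "finite F" "F \<subseteq> carrier G" for F
    using that
  proof (induction F)
    case empty
    then show ?case using zero by simp
  next
    case (insert g F)
    have "g \<in> carrier G" "component G R A x \<in> F \<rightarrow> carrier R"
      using insert.prems component_carrier xR by auto
    then have "(\<Oplus>g\<in>insert g F. component G R A x g) =
        component G R A x g \<oplus> (\<Oplus>g\<in>F. component G R A x g)"
      using insert.hyps component_carrier xR by (intro finsum_insert) auto
    then show ?case
      using insert \<open>g \<in> carrier G\<close> add homogeneous component_closed component_homogeneous x xR
      by (metis insert_subset a_closed)
  qed
  show ?thesis
    using * [OF finite_support [OF xR]] sum_of_components [OF xR finite_support [OF xR]] by auto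
qed

end

lemma graded_right_idealI:
  assumes "graded_rng G R A" "additive_subgroup P R"
    and "\<And>x r. x \<in> P \<Longrightarrow> r \<in> carrier R \<Longrightarrow> x \<otimes>\<^bsub>R\<^esub> r \<in> P"
    and "\<And>x g. x \<in> P \<Longrightarrow> g \<in> carrier G \<Longrightarrow> component G R A x g \<in> P"
  shows "graded_right_ideal G R A P"
  using assms by (simp add: graded_right_ideal_def graded_right_ideal_axioms_def)

context graded_ideal
begin

lemma square_subset: "P \<cdot> P \<subseteq> P"
proof
  fix s assume "s \<in> P \<cdot> P"
  then show "s \<in> P"
    by induction (auto intro: right_closed)
qed

lemma square_additive_subgroup: "additive_subgroup (P \<cdot> P) R"
proof (intro additive_subgroupI add.subgroupI)
  show "P \<cdot> P \<subseteq> carrier R"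
    using square_subset a_subset by blast
  show "P \<cdot> P \<noteq> {}"
    using ideal_prod.prod [OF zero_closed zero_closed] by blast
  show "\<ominus> s \<in> P \<cdot> P" if "s \<in> P \<cdot> P" for s
    using that
  proof induction
    case (prod i j)
    then show ?case
      using ideal_prod.prod [of "\<ominus> i" P j P R] by (simp add: minus_mult_left)
  next
    case (sum s t)
    then have "s \<in> carrier R" "t \<in> carrier R"
      using square_subset a_subset by auto
    then show ?case
      using sum by (simp add: minus_add ideal_prod.sum)
  qed
qed (rule ideal_prod.sum)

text \<open>For homogeneous \<open>a, b \<in> P\<close> the product \<open>ab\<close> is homogeneous, so its components are \<open>ab\<close> and
  \<open>0\<close>, both in \<open>P\<^sup>2\<close>. Biadditivity extends this to all products, by homogeneous induction in each
  factor separately.\<close>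

lemma component_square:
  assumes "s \<in> P \<cdot> P" "h \<in> carrier G"
  shows "component G R A s h \<in> P \<cdot> P"
proof -
  interpret sq: additive_subgroup "P \<cdot> P" R
    by (rule square_additive_subgroup)
  define Q where "Q s \<longleftrightarrow> s \<in> carrier R \<and> (\<forall>h\<in>carrier G. component G R A s h \<in> P \<cdot> P)" for s
  have Q_add: "Q (s \<oplus> t)" if "Q s" "Q t" for s t
    using that by (simp add: Q_def component_add)
  have Q_homogeneous: "Q s" if "g \<in> carrier G" "s \<in> A g" "s \<in> P \<cdot> P" for g s
    using that by (auto simp: Q_def component_homogeneous_element)
  have Q_zero: "Q \<zero>"
    by (rule Q_homogeneous [OF grp.one_closed
          additive_subgroup.zero_closed [OF homogeneous_subgroup [OF grp.one_closed]] sq.zero_closed])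
  have Q_mult: "Q (x \<otimes> y)" if x: "x \<in> P" and y: "y \<in> P" for x y
    using x
  proof (induction x rule: homogeneous_induct)
    case zero
    show ?case using y Q_zero by (simp add: zero_mult_left)
  next
    case (add a b)
    then show ?case using y Q_add by (simp add: l_distr)
  next
    case a: (homogeneous g a)
    show ?case
      using y
    proof (induction y rule: homogeneous_induct)
      case zero
      show ?case using a Q_zero by (simp add: zero_mult_right)
    next
      case (add b c)
      then show ?case using a Q_add by (simp add: r_distr)
    next
      case b: (homogeneous h b)
      show ?case
      proof (rule Q_homogeneous)
        show "g \<otimes>\<^bsub>G\<^esub> h \<in> carrier G"
          using a b by simp
        show "a \<otimes> b \<in> A (g \<otimes>\<^bsub>G\<^esub> h)"
          using a b by (simp add: homogeneous_mult)
        show "a \<otimes> b \<in> P \<cdot> P"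
          using a b by (simp add: ideal_prod.prod)
      qed
    qed
  qed
  have "Q s"
    using assms(1) by induction (simp_all add: Q_mult Q_add)
  then show ?thesis
    using assms(2) by (simp add: Q_def)
qed

lemma square_graded_ideal: "graded_ideal G R A (P \<cdot> P)"
proof -
  interpret sq: additive_subgroup "P \<cdot> P" R
    by (rule square_additive_subgroup)
  have right: "s \<otimes> r \<in> P \<cdot> P" if "s \<in> P \<cdot> P" and r: "r \<in> carrier R" for s r
    using that(1)
  proof induction
    case (prod i j)
    then show ?case
      using r ideal_prod.prod [of i P "j \<otimes> r" P R] right_closed by (simp add: m_assoc)
  next
    case (sum s t)
    then show ?case using r by (simp add: l_distr ideal_prod.sum)
  qed
  have left: "r \<otimes> s \<in> P \<cdot> P" if "s \<in> P \<cdot> P" and r: "r \<in> carrier R" for s r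
    using that(1)
  proof induction
    case (prod i j)
    then show ?case
      using r ideal_prod.prod [of "r \<otimes> i" P j P R] left_closed by (simp add: m_assoc [symmetric])
  next
    case (sum s t)
    then show ?case using r by (simp add: r_distr ideal_prod.sum)
  qed
  have "graded_right_ideal G R A (P \<cdot> P)"
    by (rule graded_right_idealI [OF graded_rng_axioms square_additive_subgroup right component_square])
  moreover have "P \<cdot> P \<noteq> carrier R"
    using square_subset proper a_subset by blast
  ultimately show ?thesis
    using left by (simp add: graded_ideal_def graded_ideal_axioms_def)
qed

end

section \<open>The quotient by a graded ideal\<close>

lemma (in abelian_group_hom) hom_finsum:
  assumes "f \<in> F \<rightarrow> carrier G"
  shows "h (\<Oplus>i\<in>F. f i) = (\<Oplus>\<^bsub>H\<^esub>i\<in>F. h (f i))"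
  using assms
proof (induction F rule: infinite_finite_induct)
  case (insert i F)
  then show ?case
    by (auto simp: Pi_def)
qed auto

sublocale graded_ideal \<subseteq> abelian_subgroup P R
  by (intro abelian_subgroupI3 is_additive_subgroup abelian_group_axioms)

context graded_ideal
begin

lemma quotient_carrier: "carrier (R Quot P) = quotient_image R P (carrier R)"
  by (auto simp: FactRing_simps quotient_image_def)

lemma quotient_zero: "\<zero>\<^bsub>R Quot P\<^esub> = P"
  by (simp add: FactRing_def)

lemma quotient_add:
  "x \<in> carrier R \<Longrightarrow> y \<in> carrier R \<Longrightarrow> (P +> x) \<oplus>\<^bsub>R Quot P\<^esub> (P +> y) = P +> (x \<oplus> y)"
  by (simp add: FactRing_def a_rcos_sum)

text \<open>The product of two cosets is a union over all pairs of representatives. It is a single coset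
  because \<open>(h + x)(k + y) = h(k + y) + xk + xy\<close>, and for \<open>h, k \<in> P\<close> all terms but \<open>xy\<close> lie in the
  two-sided ideal \<open>P\<close>.\<close>

lemma quotient_mult:
  assumes x: "x \<in> carrier R" and y: "y \<in> carrier R"
  shows "(P +> x) \<otimes>\<^bsub>R Quot P\<^esub> (P +> y) = P +> (x \<otimes> y)"
proof -
  have "P +> u \<otimes> v = P +> x \<otimes> y" if "u \<in> P +> x" "v \<in> P +> y" for u v
  proof -
    obtain h k where hk: "h \<in> P" "u = h \<oplus> x" "k \<in> P" "v = k \<oplus> y"
      using \<open>u \<in> P +> x\<close> \<open>v \<in> P +> y\<close> by (auto simp: a_r_coset_def')
    have "u \<otimes> v = (h \<otimes> (k \<oplus> y) \<oplus> x \<otimes> k) \<oplus> x \<otimes> y"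
      using hk x y by (simp add: l_distr [of h x] r_distr [of k y x] m_closed a_assoc)
    moreover have "h \<otimes> (k \<oplus> y) \<oplus> x \<otimes> k \<in> P"
      using hk x y by (simp add: right_closed left_closed)
    ultimately have "u \<otimes> v \<in> P +> x \<otimes> y"
      by (auto simp: a_r_coset_def')
    then show ?thesis
      using a_repr_independence' m_closed [OF x y] by simp
  qed
  moreover have "x \<in> P +> x" "y \<in> P +> y"
    using x y a_rcos_self by auto
  ultimately show ?thesis
    unfolding FactRing_def rcoset_mult_def monoid.simps by blast
qed

lemma quotient_rng: "rng (R Quot P)"
proof -
  have "abelian_group (R Quot P)"
    by (rule comm_group_abelian_groupI)
      (simp add: FactRing_def a_factorgroup_is_comm_group [unfolded A_FactGroup_def'])
  then show ?thesis
    by (auto simp: rng_def rng_axioms_def quotient_carrier quotient_image_def quotient_mult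
        quotient_add m_closed m_assoc l_distr r_distr)
qed

lemma quotient_hom: "abelian_group_hom R (R Quot P) (\<lambda>x. P +> x)"
proof (rule abelian_group_homI)
  interpret Q: rng "R Quot P"
    by (rule quotient_rng)
  show "abelian_group (R Quot P)"
    by (rule Q.abelian_group_axioms)
  show "group_hom (add_monoid R) (add_monoid (R Quot P)) (\<lambda>x. P +> x)"
  proof (rule group_hom.intro [OF a_group Q.a_group group_hom_axioms.intro], rule homI)
    show "P +> x \<in> carrier (add_monoid (R Quot P))" if "x \<in> carrier (add_monoid R)" for x
      using that by (simp add: quotient_carrier quotient_image_def)
    show "P +> (x \<otimes>\<^bsub>add_monoid R\<^esub> y) = (P +> x) \<otimes>\<^bsub>add_monoid (R Quot P)\<^esub> (P +> y)"
      if "x \<in> carrier (add_monoid R)" "y \<in> carrier (add_monoid R)" for x y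
      using that by (simp add: quotient_add)
  qed
qed (rule abelian_group_axioms)

lemma coset_eq_iff:
  assumes "x \<in> carrier R" "y \<in> carrier R"
  shows "P +> x = P +> y \<longleftrightarrow> (\<exists>k\<in>P. x = k \<oplus> y)"
proof -
  have "P +> x = P +> y \<longleftrightarrow> x \<in> P +> y"
  proof
    show "x \<in> P +> y" if "P +> x = P +> y"
      using a_rcos_self [OF assms(1)] that by simp
    show "P +> x = P +> y" if "x \<in> P +> y"
      using a_repr_independence' [OF that assms(2)] by simp
  qed
  then show ?thesis
    by (auto simp: a_r_coset_def')
qed

text \<open>A subgroup containing \<open>P\<close> is a union of cosets of \<open>P\<close>, so it can be recovered from its
  image.\<close>

lemma mem_quotient_image_iff:
  assumes "additive_subgroup S R" "P \<subseteq> S" "x \<in> carrier R"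
  shows "P +> x \<in> quotient_image R P S \<longleftrightarrow> x \<in> S"
proof
  interpret S: additive_subgroup S R by fact
  assume "P +> x \<in> quotient_image R P S"
  then obtain s where "s \<in> S" "P +> x = P +> s"
    by (auto simp: quotient_image_def)
  then show "x \<in> S"
    using assms coset_eq_iff [of x s] by auto
qed (simp add: quotient_image_def)

lemma quotient_image_additive_subgroup:
  assumes "additive_subgroup S R"
  shows "additive_subgroup (quotient_image R P S) (R Quot P)"
proof -
  interpret h: abelian_group_hom R "R Quot P" "\<lambda>x. P +> x"
    by (rule quotient_hom)
  show ?thesis
    using group_hom.subgroup_img_is_subgroup [OF h.a_group_hom] assms
    by (simp add: additive_subgroup_def quotient_image_def)
qed

lemma quotient_grading_eq:
  assumes "g \<in> carrier G"
  shows "quotient_grading R A P g = quotient_image R P (A g)"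
proof -
  interpret A: additive_subgroup "A g" R
    using assms by (rule homogeneous_subgroup)
  have sum: "P +> (a \<oplus> k) = P +> a" if a: "a \<in> A g" and k: "k \<in> P" for a k
  proof (subst coset_eq_iff)
    show "\<exists>l\<in>P. a \<oplus> k = l \<oplus> a"
      using k a_comm [of a k] a by (intro bexI [of _ k]) simp_all
  qed (use a k in simp_all)
  show ?thesis
  proof
    show "quotient_grading R A P g \<subseteq> quotient_image R P (A g)"
      unfolding quotient_grading_def quotient_image_def set_add_def' using sum by fastforce
    have "a = a \<oplus> \<zero>" if "a \<in> A g" for a
      using that by simp
    then have "A g \<subseteq> A g <+> P"
      unfolding set_add_def' using zero_closed by blast
    then show "quotient_image R P (A g) \<subseteq> quotient_grading R A P g"
      unfolding quotient_grading_def quotient_image_def by (rule image_mono)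
  qed
qed

text \<open>For uniqueness, lift the terms of a decomposition of \<open>P + x\<close> to homogeneous elements \<open>a\<^sub>g\<close>
  with sum \<open>y\<close>. Then \<open>x = k + y\<close> for some \<open>k \<in> P\<close>, hence \<open>x\<^sub>g = k\<^sub>g + a\<^sub>g\<close> with \<open>k\<^sub>g \<in> P\<close>
  because \<open>P\<close> is graded, so the given term of degree \<open>g\<close> is \<open>P + x\<^sub>g\<close>.\<close>

lemma quotient_decomposition_iff:
  assumes x: "x \<in> carrier R"
  shows "homogeneous_decomposition G (R Quot P) (quotient_grading R A P) (P +> x) f
    \<longleftrightarrow> f = (\<lambda>g\<in>carrier G. P +> component G R A x g)" (is "?dec f \<longleftrightarrow> f = ?c")
proof
  interpret h: abelian_group_hom R "R Quot P" "\<lambda>x. P +> x"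
    by (rule quotient_hom)
  show "f = ?c" if "?dec f"
  proof -
    define F where "F = {g \<in> carrier G. f g \<noteq> \<zero>\<^bsub>R Quot P\<^esub>}"
    have f: "f \<in> extensional (carrier G)" "finite F" "P +> x = (\<Oplus>\<^bsub>R Quot P\<^esub>g\<in>F. f g)"
      and "\<forall>g\<in>carrier G. f g \<in> quotient_grading R A P g"
      using that by (auto simp: homogeneous_decomposition_def F_def PiE_def)
    then have "\<forall>g\<in>carrier G. \<exists>a. a \<in> A g \<and> f g = P +> a"
      by (auto simp: quotient_grading_eq quotient_image_def)
    then obtain a where a: "\<And>g. g \<in> carrier G \<Longrightarrow> a g \<in> A g \<and> f g = P +> a g"
      by metis
    have F: "F \<subseteq> carrier G" and aF: "a \<in> F \<rightarrow> carrier R"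
      using a homogeneous_carrier by (auto simp: F_def)
    define y where "y = (\<Oplus>g\<in>F. a g)"
    have y: "y \<in> carrier R"
      using aF by (simp add: y_def)
    have "P +> y = (\<Oplus>\<^bsub>R Quot P\<^esub>g\<in>F. P +> a g)"
      using aF by (simp add: y_def h.hom_finsum)
    also have "\<dots> = P +> x"
      unfolding f(3)
    proof (rule h.H.finsum_cong')
      show "f \<in> F \<rightarrow> carrier (R Quot P)"
      proof
        fix g assume "g \<in> F"
        then show "f g \<in> carrier (R Quot P)"
          using F a [of g] homogeneous_carrier [of g "a g"] h.hom_closed [of "a g"] by auto
      qed
    qed (use F a in auto)
    finally obtain k where k: "k \<in> P" "x = k \<oplus> y"
      using coset_eq_iff x y by metis
    have "f g = P +> component G R A x g" if g: "g \<in> carrier G" for g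
    proof -
      have kg: "component G R A k g \<in> P"
        using k g by (simp add: component_closed)
      have yg: "component G R A y g = (if g \<in> F then a g else \<zero>)"
        unfolding y_def using f(2) F a g by (intro component_sum) auto
      have "component G R A x g = component G R A k g \<oplus> component G R A y g"
        using k y g by (simp add: component_add)
      then have "P +> component G R A x g = P +> component G R A y g"
        using coset_eq_iff [of "component G R A x g" "component G R A y g"]
          component_carrier [OF x g] component_carrier [OF y g] kg by blast
      also have "\<dots> = f g"
        using a [OF g] yg g by (auto simp: F_def quotient_zero a_subset)
      finally show ?thesis by simp
    qed
    then show ?thesis
      using f(1) by (intro extensionalityI [of f "carrier G"] restrict_extensional) simp_all
  qed
  show "?dec f" if f: "f = ?c"
  proof -
    define S where "S = {g \<in> carrier G. component G R A x g \<noteq> \<zero>}"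
    have S: "finite S" "S \<subseteq> carrier G"
      using finite_support [OF x] by (auto simp: S_def)
    \<comment> \<open>The support may shrink in the quotient, as nonzero components can lie in \<open>P\<close>.\<close>
    have sub: "{g \<in> carrier G. f g \<noteq> \<zero>\<^bsub>R Quot P\<^esub>} \<subseteq> S"
      by (auto simp: f S_def quotient_zero a_subset)
    have "P +> x = P +> (\<Oplus>g\<in>S. component G R A x g)"
      using sum_of_components [OF x S] by (simp add: S_def)
    also have "\<dots> = (\<Oplus>\<^bsub>R Quot P\<^esub>g\<in>S. P +> component G R A x g)"
      using S x component_carrier by (intro h.hom_finsum) auto
    also have "\<dots> = (\<Oplus>\<^bsub>R Quot P\<^esub>g\<in>{g \<in> carrier G. f g \<noteq> \<zero>\<^bsub>R Quot P\<^esub>}. f g)"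
    proof (rule h.H.add.finprod_mono_neutral_cong_right [OF S(1) sub])
      show "(\<lambda>g. P +> component G R A x g) \<in> S \<rightarrow> carrier (R Quot P)"
        using S(2) component_carrier [OF x] by (auto intro!: h.hom_closed)
    qed (use S(2) in \<open>auto simp: f\<close>)
    finally have sum: "P +> x =
        (\<Oplus>\<^bsub>R Quot P\<^esub>g\<in>{g \<in> carrier G. f g \<noteq> \<zero>\<^bsub>R Quot P\<^esub>}. f g)" .
    have "f g \<in> quotient_grading R A P g" if "g \<in> carrier G" for g
      using that component_homogeneous [OF x that] by (simp add: f quotient_grading_eq quotient_image_def)
    then have "f \<in> (\<Pi>\<^sub>E g\<in>carrier G. quotient_grading R A P g)"
      by (simp add: f PiE_iff del: restrict_apply)
    then show ?thesis
      unfolding homogeneous_decomposition_def using finite_subset [OF sub S(1)] sum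
      by (intro conjI)
  qed
qed

lemma quotient_graded_rng: "graded_rng G (R Quot P) (quotient_grading R A P)"
proof -
  have "u \<otimes>\<^bsub>R Quot P\<^esub> v \<in> quotient_grading R A P (g \<otimes>\<^bsub>G\<^esub> h)"
    if "g \<in> carrier G" "h \<in> carrier G" "u \<in> quotient_grading R A P g" "v \<in> quotient_grading R A P h"
    for g h u v
    using that homogeneous_mult homogeneous_carrier
    by (auto simp: quotient_grading_eq quotient_image_def quotient_mult)
  moreover have "\<exists>!f. homogeneous_decomposition G (R Quot P) (quotient_grading R A P) u f"
    if "u \<in> carrier (R Quot P)" for u
    using that by (auto simp: quotient_carrier quotient_image_def quotient_decomposition_iff)
  moreover have "additive_subgroup (quotient_grading R A P g) (R Quot P)" if "g \<in> carrier G" for g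
    using that by (simp add: quotient_grading_eq quotient_image_additive_subgroup homogeneous_subgroup)
  ultimately show ?thesis
    using quotient_rng grp.group_axioms
    by (auto simp: graded_rng_def graded_rng_axioms_def)
qed

lemma quotient_component:
  assumes "x \<in> carrier R" "g \<in> carrier G"
  shows "component G (R Quot P) (quotient_grading R A P) (P +> x) g = P +> component G R A x g"
proof -
  have "component G (R Quot P) (quotient_grading R A P) (P +> x) =
      (\<lambda>g\<in>carrier G. P +> component G R A x g)"
  proof (rule graded_rng.component_unique [OF quotient_graded_rng])
    show "P +> x \<in> carrier (R Quot P)"
      using assms(1) by (simp add: quotient_carrier quotient_image_def)
  qed (simp only: quotient_decomposition_iff [OF assms(1)])
  then show ?thesis
    using assms(2) by simp
qed

lemma quotient_image_graded_right_ideal: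
  assumes "graded_right_ideal G R A X"
  shows "graded_right_ideal G (R Quot P) (quotient_grading R A P) (quotient_image R P X)"
proof -
  interpret X: graded_right_ideal G R A X by fact
  show ?thesis
  proof (rule graded_right_idealI [OF quotient_graded_rng])
    show "additive_subgroup (quotient_image R P X) (R Quot P)"
      by (intro quotient_image_additive_subgroup X.is_additive_subgroup)
  qed (auto simp: quotient_carrier quotient_image_def quotient_mult quotient_component
      X.right_closed X.component_closed)
qed

lemma preimage_graded_right_ideal:
  assumes "graded_right_ideal G (R Quot P) (quotient_grading R A P) X"
  shows "graded_right_ideal G R A {x \<in> carrier R. P +> x \<in> X}" (is "graded_right_ideal G R A ?Y")
proof -
  interpret X: graded_right_ideal G "R Quot P" "quotient_grading R A P" X by fact
  interpret h: abelian_group_hom R "R Quot P" "\<lambda>x. P +> x"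
    by (rule quotient_hom)
  show ?thesis
  proof (rule graded_right_idealI [OF graded_rng_axioms])
    show "additive_subgroup ?Y R"
    proof (intro additive_subgroupI add.subgroupI)
      have "P +> \<zero> \<in> X"
        using X.zero_closed by (simp only: h.hom_zero)
      then show "?Y \<noteq> {}"
        by blast
      show "\<ominus> x \<in> ?Y" if "x \<in> ?Y" for x
        using that X.a_inv_closed by (auto simp: h.hom_a_inv)
      show "x \<oplus> y \<in> ?Y" if "x \<in> ?Y" "y \<in> ?Y" for x y
        using that X.a_closed by (auto simp: h.hom_add)
    qed blast
    show "x \<otimes> r \<in> ?Y" if "x \<in> ?Y" "r \<in> carrier R" for x r
      using that X.right_closed [of "P +> x" "P +> r"] h.hom_closed [of r]
      by (auto simp: quotient_mult m_closed)
    show "component G R A x g \<in> ?Y" if "x \<in> ?Y" "g \<in> carrier G" for x g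
      using that X.component_closed [of "P +> x" g] by (auto simp: quotient_component component_carrier)
  qed
qed

lemma quotient_image_preimage:
  assumes "X \<subseteq> carrier (R Quot P)"
  shows "quotient_image R P {x \<in> carrier R. P +> x \<in> X} = X"
  using assms by (auto simp: quotient_carrier quotient_image_def)

lemma product_in_carrier:
  assumes "X \<subseteq> carrier R" "Y \<subseteq> carrier R"
  shows "X \<cdot> Y \<subseteq> carrier R"
proof
  fix s assume "s \<in> X \<cdot> Y"
  then show "s \<in> carrier R"
    by induction (use assms m_closed in auto)
qed

lemma quotient_image_product:
  assumes "X \<subseteq> carrier R" "Y \<subseteq> carrier R"
  shows "quotient_image R P (X \<cdot> Y) = quotient_image R P X \<cdot>\<^bsub>R Quot P\<^esub> quotient_image R P Y"
proof
  have "P +> s \<in> quotient_image R P X \<cdot>\<^bsub>R Quot P\<^esub> quotient_image R P Y" if "s \<in> X \<cdot> Y" for s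
    using that
  proof induction
    case (prod i j)
    then have "P +> i \<in> quotient_image R P X" "P +> j \<in> quotient_image R P Y"
      by (auto simp: quotient_image_def)
    from ideal_prod.prod [OF this, of "R Quot P"] show ?case
      using prod assms by (simp add: quotient_mult subset_iff)
  next
    case (sum s t)
    then have "s \<in> carrier R" "t \<in> carrier R"
      using product_in_carrier [OF assms] by auto
    with ideal_prod.sum [OF sum.IH] show ?case
      by (simp add: quotient_add)
  qed
  then show "quotient_image R P (X \<cdot> Y) \<subseteq> quotient_image R P X \<cdot>\<^bsub>R Quot P\<^esub> quotient_image R P Y"
    by (auto simp: quotient_image_def)
  have "u \<in> quotient_image R P (X \<cdot> Y)"
    if "u \<in> quotient_image R P X \<cdot>\<^bsub>R Quot P\<^esub> quotient_image R P Y" for u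
    using that
  proof induction
    case (prod i j)
    then obtain x y where "x \<in> X" "y \<in> Y" "i = P +> x" "j = P +> y"
      by (auto simp: quotient_image_def)
    then show ?case
      using assms ideal_prod.prod [of x X y Y R] by (auto simp: quotient_mult subset_iff quotient_image_def)
  next
    case (sum u v)
    then obtain s t where st: "s \<in> X \<cdot> Y" "t \<in> X \<cdot> Y" "u = P +> s" "v = P +> t"
      by (auto simp: quotient_image_def)
    then have "s \<in> carrier R" "t \<in> carrier R"
      using product_in_carrier [OF assms] by auto
    then show ?case
      using st ideal_prod.sum [of s R X Y t] by (auto simp: quotient_add quotient_image_def)
  qed
  then show "quotient_image R P X \<cdot>\<^bsub>R Quot P\<^esub> quotient_image R P Y \<subseteq> quotient_image R P (X \<cdot> Y)"
    by blast
qed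

text \<open>Nonemptiness excludes an empty product, which would be contained in \<open>P\<close> but have an image
  different from \<open>{0}\<close>.\<close>

lemma quotient_product_zero_iff:
  assumes "X \<subseteq> carrier R" "Y \<subseteq> carrier R" "X \<noteq> {}" "Y \<noteq> {}"
  shows "quotient_image R P X \<cdot>\<^bsub>R Quot P\<^esub> quotient_image R P Y = {\<zero>\<^bsub>R Quot P\<^esub>} \<longleftrightarrow> X \<cdot> Y \<subseteq> P"
proof -
  obtain x y where "x \<in> X" "y \<in> Y"
    using assms(3,4) by blast
  then have nonempty: "X \<cdot> Y \<noteq> {}"
    using ideal_prod.prod [of x X y Y R] by blast
  have coset: "P +> s = P \<longleftrightarrow> s \<in> P" if "s \<in> X \<cdot> Y" for s
    using that product_in_carrier [OF assms(1,2)] a_rcos_const [of s] a_rcos_self [of s] by auto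
  have "quotient_image R P (X \<cdot> Y) = {P} \<longleftrightarrow> (\<forall>s\<in>X \<cdot> Y. P +> s = P)"
    unfolding quotient_image_def using nonempty by blast
  also have "\<dots> \<longleftrightarrow> X \<cdot> Y \<subseteq> P"
    using coset by blast
  finally show ?thesis
    by (simp only: quotient_image_product [OF assms(1,2)] quotient_zero)
qed

end

section \<open>Transfer of primeness\<close>

theorem theorem2p11:
  fixes G :: "('g, 'm) monoid_scheme" and R :: "('a, 'n) ring_scheme"
    and A :: "'g \<Rightarrow> 'a set" and I :: "'a set"
  assumes "group G" and "graded_rng G R A" and "graded_ideal G R A I"
  shows "graded_almost_prime G R A I \<longleftrightarrow>
    graded_weakly_prime G (R Quot (I \<cdot>\<^bsub>R\<^esub> I)) (quotient_grading R A (I \<cdot>\<^bsub>R\<^esub> I))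
      (quotient_image R (I \<cdot>\<^bsub>R\<^esub> I) I)"
proof -
  interpret I: graded_ideal G R A I by fact
  define K where "K = I \<cdot>\<^bsub>R\<^esub> I"
  interpret K: graded_ideal G R A K
    unfolding K_def by (rule I.square_graded_ideal)
  let ?\<pi> = "quotient_image R K" and ?Q = "R Quot K" and ?B = "quotient_grading R A K"
  have KI: "K \<subseteq> I"
    unfolding K_def by (rule I.square_subset)
  have image_subset: "?\<pi> S \<subseteq> ?\<pi> I \<longleftrightarrow> S \<subseteq> I" if "S \<subseteq> carrier R" for S
  proof -
    have "K +>\<^bsub>R\<^esub> s \<in> ?\<pi> I \<longleftrightarrow> s \<in> I" if "s \<in> S" for s
      using that \<open>S \<subseteq> carrier R\<close>
      by (intro K.mem_quotient_image_iff [OF I.is_additive_subgroup KI]) auto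
    then show ?thesis
      unfolding quotient_image_def [of R K S] by auto
  qed
  have "graded_weakly_prime G ?Q ?B (?\<pi> I)" if "graded_almost_prime G R A I"
  proof -
    interpret ap: graded_almost_prime G R A I by fact
    have "graded_weakly_prime_axioms G ?Q ?B (?\<pi> I)"
    proof
      show "?\<pi> I \<noteq> carrier ?Q"
        using image_subset [of "carrier R"] I.proper I.a_subset by (auto simp: K.quotient_carrier)
    next
      fix X Y
      assume X: "graded_right_ideal G ?Q ?B X" and Y: "graded_right_ideal G ?Q ?B Y"
        and nonzero: "X \<cdot>\<^bsub>?Q\<^esub> Y \<noteq> {\<zero>\<^bsub>?Q\<^esub>}" and sub: "X \<cdot>\<^bsub>?Q\<^esub> Y \<subseteq> ?\<pi> I"
      interpret X: graded_right_ideal G ?Q ?B X by fact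
      interpret Y: graded_right_ideal G ?Q ?B Y by fact
      define X' where "X' = {x \<in> carrier R. K +>\<^bsub>R\<^esub> x \<in> X}"
      define Y' where "Y' = {y \<in> carrier R. K +>\<^bsub>R\<^esub> y \<in> Y}"
      have image: "?\<pi> X' = X" "?\<pi> Y' = Y"
        unfolding X'_def Y'_def
        by (rule K.quotient_image_preimage, rule X.a_subset)
          (rule K.quotient_image_preimage, rule Y.a_subset)
      interpret X': graded_right_ideal G R A X'
        unfolding X'_def by (rule K.preimage_graded_right_ideal [OF X])
      interpret Y': graded_right_ideal G R A Y'
        unfolding Y'_def by (rule K.preimage_graded_right_ideal [OF Y])
      note c = X'.a_subset Y'.a_subset
      have nonempty: "X' \<noteq> {}" "Y' \<noteq> {}"
        using X'.zero_closed Y'.zero_closed by blast+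
      have "?\<pi> (X' \<cdot>\<^bsub>R\<^esub> Y') \<subseteq> ?\<pi> I"
        using sub by (simp only: K.quotient_image_product [OF c] image)
      then have "X' \<cdot>\<^bsub>R\<^esub> Y' \<subseteq> I"
        by (simp only: image_subset [OF K.product_in_carrier [OF c]])
      moreover have "\<not> X' \<cdot>\<^bsub>R\<^esub> Y' \<subseteq> I \<cdot>\<^bsub>R\<^esub> I"
        using nonzero K.quotient_product_zero_iff [OF c nonempty]
        unfolding K_def [symmetric] image by simp
      ultimately have "X' \<subseteq> I \<or> Y' \<subseteq> I"
        by (intro ap.almost_prime X'.graded_right_ideal_axioms Y'.graded_right_ideal_axioms)
      then show "X \<subseteq> ?\<pi> I \<or> Y \<subseteq> ?\<pi> I"
        using image_subset [OF c(1)] image_subset [OF c(2)] unfolding image by simp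
    qed
    then show ?thesis
      by (intro graded_weakly_prime.intro K.quotient_image_graded_right_ideal
          I.graded_right_ideal_axioms)
  qed
  moreover have "graded_almost_prime G R A I" if "graded_weakly_prime G ?Q ?B (?\<pi> I)"
  proof -
    interpret wp: graded_weakly_prime G ?Q ?B "?\<pi> I" by fact
    have "graded_almost_prime_axioms G R A I"
    proof
      fix X Y
      assume X: "graded_right_ideal G R A X" and Y: "graded_right_ideal G R A Y"
        and sub: "X \<cdot>\<^bsub>R\<^esub> Y \<subseteq> I" and nsub: "\<not> X \<cdot>\<^bsub>R\<^esub> Y \<subseteq> I \<cdot>\<^bsub>R\<^esub> I"
      interpret X: graded_right_ideal G R A X by fact
      interpret Y: graded_right_ideal G R A Y by fact
      note c = X.a_subset Y.a_subset
      have nonempty: "X \<noteq> {}" "Y \<noteq> {}"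
        using X.zero_closed Y.zero_closed by blast+
      have "?\<pi> X \<cdot>\<^bsub>?Q\<^esub> ?\<pi> Y \<noteq> {\<zero>\<^bsub>?Q\<^esub>}"
        using nsub K.quotient_product_zero_iff [OF c nonempty]
        unfolding K_def [symmetric] by simp
      moreover have "?\<pi> X \<cdot>\<^bsub>?Q\<^esub> ?\<pi> Y \<subseteq> ?\<pi> I"
        using sub
        by (simp only: K.quotient_image_product [OF c, symmetric]
            image_subset [OF K.product_in_carrier [OF c]])
      ultimately have "?\<pi> X \<subseteq> ?\<pi> I \<or> ?\<pi> Y \<subseteq> ?\<pi> I"
        by (intro wp.weakly_prime K.quotient_image_graded_right_ideal X Y)
      then show "X \<subseteq> I \<or> Y \<subseteq> I"
        by (simp only: image_subset [OF c(1)] image_subset [OF c(2)])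
    qed (rule I.proper)
    then show ?thesis
      by (intro graded_almost_prime.intro I.graded_right_ideal_axioms)
  qed
  ultimately show ?thesis
    unfolding K_def by blast
qed

end
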